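(* Let $\beta\in(0,1/2)$, let $\Omega=(a,b)$ be a bounded interval divided into $M$ equal subintervals of length $h=(b-a)/M$, and let $A_h^\beta=(a^{\beta,h}_{i,j})$ be the $(M-1)\times(M-1)$ stiffness matrix defined in the context. Let $\beta_0$ denote the unique root in $(0,1/2)$ of the equation $3^{3-2\beta}-2^{5-2\beta}+7=0$. Then: 1. $a^{\beta,h}_{i,i}>0$ for $i=1,\dots,M-1$. 2. If $\beta>\beta_0$, then $a^{\beta,h}_{i,j}<0$ for all $i\neq j$, $i,j=1,\dots,M-1$. Otherwise, $a^{\beta,h}_{k,k+1}=a^{\beta,h}_{k+1,k}\ge 0$ for $k=1,\dots,M-2$, and $a^{\beta,h}_{i,j}<0$ for all $i,j=1,\dots,M-1$ with $|i-j|>1$. 3. $\sum_{j=1}^{M-1}a^{\beta,h}_{i,j}>0$ for $i=1,\dots,M-1$. Thus $A_h^\beta$ is an M-matrix if and only if $\beta\ge\beta_0$. Moreover, in the particular case when $h\le 1/7$, $$\sum_{j=1}^{M-1}a^{\beta,h}_{i,j}\ \ge\ -\frac{h^{1-2\beta}(4-2^{3-2\beta})}{2\cos(\beta\pi)\Gamma(4-2\beta)}\quad\text{for } i=1 \text{ and } i=M-1,$$ $$\sum_{j=1}^{M-1}a^{\beta,h}_{i,j}\ \ge\ -\frac{2^{2\beta}h(2\beta-1)}{\cos(\beta\pi)\Gamma(2-2\beta)}\quad\text{for } i=2,\dots,M-2.$$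
   Context: The matrix $A_h^\beta=(a^{\beta,h}_{i,j})_{(M-1)\times(M-1)}$ is the symmetric Toeplitz matrix with entries $$a^{\beta,h}_{i,i}=\frac{h^{1-2\beta}(2^{4-2\beta}-8)}{2\cos(\beta\pi)\Gamma(4-2\beta)},\qquad i=1,\dots,M-1,$$ $$a^{\beta,h}_{j,j+1}=a^{\beta,h}_{j+1,j}=\frac{h^{1-2\beta}(3^{3-2\beta}-2^{5-2\beta}+7)}{2\cos(\beta\pi)\Gamma(4-2\beta)},\qquad j=1,\dots,M-2,$$ and, for $l\ge2$ and $k=1,\dots,M-l-1$, $$a^{\beta,h}_{k,k+l}=a^{\beta,h}_{k+l,k}=\frac{h^{1-2\beta}}{2\cos(\beta\pi)\Gamma(4-2\beta)}\big[(l+2)^{3-2\beta}-4(l+1)^{3-2\beta}+6l^{3-2\beta}-4(l-1)^{3-2\beta}+(l-2)^{3-2\beta}\big].$$ (It arises as the stiffness matrix of the advection term, a Riesz fractional derivative of order $2\beta$, for continuous piecewise linear finite elements vanishing at $a$ and $b$ on the uniform mesh $x_i=a+ih$.) An M-matrix is a real square matrix with positive diagonal entries and nonpositive off-diagonal entries which is nonsingular and whose inverse is entrywise nonnegative.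
   Formalization: The "only if" of the M-matrix claim is stated for M≥3 (for M=2 it fails). The last bound (i=2,…,M-2) is false in general if b-a>1; it is stated for b-a≤1, and for all intervals with the extra factor (b-a)^{-2β} on the right-hand side. *)

theory Defs
  imports "HOL-Analysis.Gamma_Function" "Jordan_Normal_Form.Matrix"
begin

text \<open>
  Entries of the stiffness matrix. Row and column indices run over \<open>1, \<dots>, M - 1\<close>, i.e. over the
  interior mesh points. For \<open>l = 2\<close> the last summand is \<open>0 powr (3 - 2 * \<beta>) = 0\<close>.
\<close>

definition stiff_entry :: "real \<Rightarrow> real \<Rightarrow> nat \<Rightarrow> nat \<Rightarrow> real" where
  "stiff_entry \<beta> h i j =
    (let l = \<bar>real i - real j\<bar>;
         c = h powr (1 - 2 * \<beta>) / (2 * cos (\<beta> * pi) * Gamma (4 - 2 * \<beta>))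
     in if l = 0 then c * (2 powr (4 - 2 * \<beta>) - 8)
        else if l = 1 then c * (3 powr (3 - 2 * \<beta>) - 2 powr (5 - 2 * \<beta>) + 7)
        else c * ((l + 2) powr (3 - 2 * \<beta>) - 4 * (l + 1) powr (3 - 2 * \<beta>) + 6 * l powr (3 - 2 * \<beta>)
                  - 4 * (l - 1) powr (3 - 2 * \<beta>) + (l - 2) powr (3 - 2 * \<beta>)))"

text \<open>Matrices are indexed from 0, whence the shift.\<close>

definition stiff_mat :: "real \<Rightarrow> real \<Rightarrow> nat \<Rightarrow> real mat" where
  "stiff_mat \<beta> h M = mat (M - 1) (M - 1) (\<lambda>(i, j). stiff_entry \<beta> h (i + 1) (j + 1))"

definition M_matrix :: "real mat \<Rightarrow> bool" where
  "M_matrix A \<longleftrightarrow>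
     square_mat A \<and>
     (\<forall>i < dim_row A. A $$ (i, i) > 0) \<and>
     (\<forall>i < dim_row A. \<forall>j < dim_row A. i \<noteq> j \<longrightarrow> A $$ (i, j) \<le> 0) \<and>
     invertible_mat A \<and>
     (\<forall>B. inverts_mat A B \<and> inverts_mat B A \<longrightarrow>
          (\<forall>i < dim_row A. \<forall>j < dim_row A. B $$ (i, j) \<ge> 0))"

definition is_root_beta :: "real \<Rightarrow> bool" where
  "is_root_beta x \<longleftrightarrow>
     0 < x \<and> x < 1 / 2 \<and> 3 powr (3 - 2 * x) - 2 powr (5 - 2 * x) + 7 = 0"

definition beta0 :: real where
  "beta0 = (THE x. is_root_beta x)"

end

theory Submission
  imports Defs "Jordan_Normal_Form.Determinant"
begin

text \<open>
  Write \<open>s = 3 - 2\<beta>\<close>. The \<open>(i, j)\<close> entry is a positive constant times the fourth difference of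
  \<open>g(x) = \<bar>x\<bar>\<^sup>s\<close>, centred at \<open>i - j\<close>. The mean value theorem for differences therefore gives the
  signs away from the diagonal and its two neighbours, since \<open>x\<^sup>s\<close> has negative fourth derivative,
  and the row sums telescope to two third differences of \<open>g\<close>, which are positive.
  A matrix with nonpositive off-diagonal entries and positive row sums satisfies a discrete minimum
  principle, hence is an M-matrix. The lower bounds for the interior rows come from replacing the
  convex third derivative of \<open>x\<^sup>s\<close> by its tangent at \<open>M / 2\<close>.
\<close>

subsection \<open>Forward differences\<close>

text \<open>The step is 1. The recursion splits off the outermost difference, so that the ordinary
  mean value theorem can act on it first.\<close>

primrec fwd_diff :: "nat \<Rightarrow> (real \<Rightarrow> real) \<Rightarrow> real \<Rightarrow> real" where
  "fwd_diff 0 F = F"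
| "fwd_diff (Suc n) F = (\<lambda>x. fwd_diff n F (x + 1) - fwd_diff n F x)"

lemma fwd_diff_3: "fwd_diff 3 F x = F (x + 3) - 3 * F (x + 2) + 3 * F (x + 1) - F x"
  by (simp add: eval_nat_numeral add.assoc)

lemma fwd_diff_4:
  "fwd_diff 4 F x = F (x + 4) - 4 * F (x + 3) + 6 * F (x + 2) - 4 * F (x + 1) + F x"
  by (simp add: eval_nat_numeral add.assoc)

lemma continuous_on_fwd_diff:
  assumes "continuous_on {x..} F"
  shows "continuous_on {x..} (fwd_diff n F)"
proof (induction n)
  case 0
  then show ?case using assms by simp
next
  case (Suc n)
  have "continuous_on {x..} (\<lambda>y. fwd_diff n F (y + 1))"
    by (rule continuous_on_compose2[OF Suc]) (auto intro!: continuous_intros)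
  with Suc show ?case by (auto intro!: continuous_intros)
qed

lemma has_real_derivative_fwd_diff:
  assumes "\<And>y. x < y \<Longrightarrow> (F has_real_derivative F' y) (at y)" and "x < y"
  shows "(fwd_diff n F has_real_derivative fwd_diff n F' y) (at y)"
  using assms(2)
proof (induction n arbitrary: y)
  case 0
  then show ?case using assms(1) by simp
next
  case (Suc n)
  have "((\<lambda>y. fwd_diff n F (y + 1)) has_real_derivative fwd_diff n F' (y + 1)) (at y)"
    using Suc.IH[of "y + 1"] Suc.prems by (simp add: DERIV_shift)
  with Suc show ?case by (auto intro!: derivative_intros)
qed

text \<open>Each induction step trades one difference for one derivative; \<open>F k\<close> is the
  \<open>k\<close>-th derivative of \<open>F 0\<close>. Derivatives are required only to the right
  of \<open>x\<close>, so that \<open>y powr s\<close> is covered at \<open>x = 0\<close>, where its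
  higher derivatives need not exist.\<close>

lemma fwd_diff_mvt:
  fixes F :: "nat \<Rightarrow> real \<Rightarrow> real"
  assumes "0 < n" and "continuous_on {x..} (F 0)"
    and "\<And>k y. k < n \<Longrightarrow> x < y \<Longrightarrow> (F k has_real_derivative F (Suc k) y) (at y)"
  shows "\<exists>z>x. fwd_diff n (F 0) x = F n z"
  using assms
proof (induction n arbitrary: F x)
  case 0
  then show ?case by simp
next
  case (Suc n)
  let ?G = "fwd_diff n (F 0)"
  have dG: "(?G has_real_derivative fwd_diff n (F 1) y) (at y)" if "x < y" for y
    using Suc.prems(3)[of 0] that by (intro has_real_derivative_fwd_diff[of x]) auto
  have "\<exists>l z. x < z \<and> z < x + 1 \<and> DERIV ?G z :> l \<and> ?G (x + 1) - ?G x = (x + 1 - x) * l"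
  proof (rule MVT)
    show "continuous_on {x..x + 1} ?G"
      using continuous_on_fwd_diff[OF Suc.prems(2)] by (rule continuous_on_subset) auto
    show "?G differentiable at y" if "x < y" for y
      using dG[OF that] by (auto simp: real_differentiable_def)
  qed simp
  then obtain l z where z: "x < z" "DERIV ?G z :> l" "?G (x + 1) - ?G x = l"
    by auto
  have l: "fwd_diff (Suc n) (F 0) x = fwd_diff n (F 1) z"
    using z DERIV_unique[OF z(2) dG[OF z(1)]] by simp
  show ?case
  proof (cases "n = 0")
    case True
    then show ?thesis using l z(1) by auto
  next
    case False
    \<comment> \<open>The remaining differences act on \<open>F 1\<close> from the new base point
      \<open>z\<close>, where continuity follows from differentiability because
      \<open>z > x\<close>.\<close>
    have "\<exists>w>z. fwd_diff n ((\<lambda>k. F (Suc k)) 0) z = F (Suc n) w"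
    proof (rule Suc.IH)
      show "continuous_on {z..} (F (Suc 0))"
      proof (intro continuous_at_imp_continuous_on ballI)
        fix y assume "y \<in> {z..}"
        then show "isCont (F (Suc 0)) y"
          using Suc.prems(3)[of 1 y] False z(1) by (auto intro: DERIV_isCont)
      qed
      show "(F (Suc k) has_real_derivative F (Suc (Suc k)) y) (at y)" if "k < n" "z < y" for k y
        using Suc.prems(3)[of "Suc k"] that z(1) by simp
    qed (use False in simp)
    then obtain w where w: "z < w" "fwd_diff n (F (Suc 0)) z = F (Suc n) w" by auto
    have "fwd_diff (Suc n) (F 0) x = F (Suc n) w" using l w(2) by simp
    with less_trans[OF z(1) w(1)] show ?thesis by blast
  qed
qed

section \<open>Differences of powers\<close>

lemma continuous_on_powr_atLeast:
  fixes x s :: real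
  assumes "0 \<le> x" "0 < s"
  shows "continuous_on {x..} (\<lambda>y. y powr s)"
  by (rule continuous_on_powr') (use assms in \<open>auto intro: continuous_intros\<close>)

lemma fwd_diff_powr:
  assumes "0 < n" "0 \<le> x" "0 < s"
  shows "\<exists>z>x. fwd_diff n (\<lambda>y. y powr s) x = (\<Prod>k<n. s - real k) * z powr (s - real n)"
proof -
  define F where "F = (\<lambda>m y. (\<Prod>k<m. s - real k) * y powr (s - real m))"
  have "\<exists>z>x. fwd_diff n (F 0) x = F n z"
  proof (rule fwd_diff_mvt)
    show "continuous_on {x..} (F 0)"
      using continuous_on_powr_atLeast[OF assms(2,3)] by (simp add: F_def)
    show "(F k has_real_derivative F (Suc k) y) (at y)" if "x < y" for k y
    proof -
      have "((\<lambda>y. (\<Prod>i<k. s - real i) * y powr (s - real k)) has_real_derivative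
          (\<Prod>i<k. s - real i) * ((s - real k) * y powr (s - real k - 1))) (at y)"
        using that assms(2) by (intro DERIV_cmult has_real_derivative_powr) simp
      then show ?thesis by (simp add: F_def mult.assoc diff_diff_eq add.commute)
    qed
  qed fact
  then show ?thesis by (simp add: F_def)
qed

lemma fwd_diff_3_powr_pos:
  assumes "0 \<le> x" "2 < s"
  shows "0 < fwd_diff 3 (\<lambda>y. y powr s) x"
proof -
  have "(\<Prod>k<3. s - real k) = s * (s - 1) * (s - 2)"
    by (simp add: numeral_3_eq_3)
  then show ?thesis using fwd_diff_powr[of 3 x s] assms by auto
qed

text \<open>Of the factors of \<open>s * (s - 1) * (s - 2) * (s - 3)\<close> only the last is
  negative.\<close>

lemma fwd_diff_4_powr_neg:
  assumes "0 \<le> x" "2 < s" "s < 3"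
  shows "fwd_diff 4 (\<lambda>y. y powr s) x < 0"
proof -
  have "(\<Prod>k<4. s - real k) = s * (s - 1) * (s - 2) * (s - 3)"
    by (simp add: eval_nat_numeral)
  then show ?thesis
    using fwd_diff_powr[of 4 x s] assms by (auto simp: mult_less_0_iff zero_less_mult_iff)
qed

text \<open>Convexity of a negative power: after scaling by \<open>c\<close> it follows from
  \<open>ln u \<le> u - 1\<close> and \<open>exp t \<ge> 1 + t\<close>.\<close>

lemma powr_neg_ge_tangent:
  fixes c y r :: real
  assumes "0 < c" "0 < y" "0 \<le> r"
  shows "c powr (- r) - r * c powr (- r - 1) * (y - c) \<le> y powr (- r)"
proof -
  have "1 - r * (y / c - 1) \<le> 1 - r * ln (y / c)"
    using assms ln_le_minus_one[of "y / c"] by (simp add: mult_left_mono)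
  also have "\<dots> \<le> exp (- r * ln (y / c))"
    using exp_ge_add_one_self[of "- r * ln (y / c)"] by simp
  also have "\<dots> = (y / c) powr (- r)"
    using assms by (simp add: powr_def)
  finally have "c powr (- r) * (1 - r * (y / c - 1)) \<le> c powr (- r) * (y / c) powr (- r)"
    by (intro mult_left_mono) auto
  also have "\<dots> = y powr (- r)"
    using assms by (simp flip: powr_mult)
  finally show ?thesis
    using assms by (simp add: powr_diff field_simps)
qed

text \<open>Subtract from \<open>y powr s\<close> a quartic whose third derivative is the tangent at
  \<open>c\<close> to the third derivative of \<open>y powr s\<close>. By convexity the remainder
  has a nonnegative third derivative, hence a nonnegative third difference. The third difference of
  the quartic is its affine third derivative at \<open>x + 3 / 2\<close>, the midpoint of the
  nodes.\<close>

lemma fwd_diff_3_powr_ge: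
  fixes s c x :: real
  assumes "2 < s" "s < 3" "0 < c" "0 \<le> x"
  defines "A \<equiv> s * (s - 1) * (s - 2)"
  shows "A * (c powr (s - 3) + (s - 3) * c powr (s - 4) * (x + 3 / 2 - c))
    \<le> fwd_diff 3 (\<lambda>y. y powr s) x"
proof -
  define p where "p = A * c powr (s - 3)"
  define q where "q = A * (s - 3) * c powr (s - 4)"
  define F where "F = (\<lambda>k::nat.
    if k = 0 then (\<lambda>y. y powr s - p * y ^ 3 / 6 - q * (y - c) ^ 4 / 24)
    else if k = 1 then (\<lambda>y. s * y powr (s - 1) - p * y ^ 2 / 2 - q * (y - c) ^ 3 / 6)
    else if k = 2 then (\<lambda>y. s * (s - 1) * y powr (s - 2) - p * y - q * (y - c) ^ 2 / 2)
    else (\<lambda>y. A * y powr (s - 3) - p - q * (y - c)))"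
  have "\<exists>z>x. fwd_diff 3 (F 0) x = F 3 z"
  proof (rule fwd_diff_mvt)
    show "continuous_on {x..} (F 0)"
      using assms
      by (simp add: F_def, intro continuous_on_diff continuous_on_powr_atLeast)
        (auto intro!: continuous_intros)
    show "(F k has_real_derivative F (Suc k) y) (at y)" if k: "k < 3" and "x < y" for k y
    proof -
      have "0 < y" using that assms by simp
      consider "k = 0" | "k = 1" | "k = 2" using k by linarith
      then show ?thesis
        using \<open>0 < y\<close> by cases
          (auto simp: F_def A_def field_simps power2_eq_square power3_eq_cube
             intro!: derivative_eq_intros)
    qed
  qed simp
  then obtain z where z: "z > x" "fwd_diff 3 (F 0) x = F 3 z" by blast
  have "A \<ge> 0" using assms(1) by (simp add: A_def)
  moreover have "c powr (s - 3) + (s - 3) * c powr (s - 4) * (z - c) \<le> z powr (s - 3)"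
    using powr_neg_ge_tangent[of c z "3 - s"] z(1) assms(2-4) by (simp add: algebra_simps)
  ultimately have "0 \<le> A * (z powr (s - 3) - (c powr (s - 3) + (s - 3) * c powr (s - 4) * (z - c)))"
    by simp
  also have "\<dots> = F 3 z"
    by (simp add: F_def p_def q_def algebra_simps)
  also have "\<dots> = fwd_diff 3 (F 0) x" using z(2) by simp
  also have "\<dots> = fwd_diff 3 (\<lambda>y. y powr s) x - p - q * (x + 3 / 2 - c)"
    by (simp add: F_def fwd_diff_3 field_simps power3_eq_cube power4_eq_xxxx)
  finally show ?thesis by (simp add: p_def q_def algebra_simps)
qed

subsection \<open>The root \<open>\<beta>\<^sub>0\<close>\<close>

text \<open>
  Dividing by \<open>2\<^sup>s\<close> makes the function convex, so that it has at most one zero besides \<open>s = 2\<close>.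
\<close>

definition root_fun :: "real \<Rightarrow> real" where
  "root_fun s = (3 / 2) powr s - 4 + 7 * (1 / 2) powr s"

lemma root_fun_eq: "3 powr s - 2 powr (s + 2) + 7 = 2 powr s * root_fun s"
  by (simp add: root_fun_def powr_add powr_divide field_simps)

text \<open>This zero belongs to the excluded value \<open>\<beta> = 1 / 2\<close>; it supplies an
  extra point for Rolle's theorem in the uniqueness proof.\<close>

lemma root_fun_2: "root_fun 2 = 0"
  by (simp add: root_fun_def power2_eq_square)

lemma root_fun_3: "root_fun 3 > 0"
  by (simp add: root_fun_def eval_nat_numeral)

text \<open>A negative value inside (2, 3) is what forces a zero there. The claim amounts to
  \<open>9 * sqrt 3 + 7 < 16 * sqrt 2\<close>.\<close>

lemma root_fun_5_half: "root_fun (5 / 2) < 0"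
proof -
  have split: "x powr (5 / 2) = x ^ 2 * sqrt x" if "x > 0" for x :: real
  proof -
    have "x powr (5 / 2) = x powr (2 + 1 / 2)" by simp
    also have "\<dots> = x powr 2 * x powr (1 / 2)" by (rule powr_add)
    finally show ?thesis using that by (simp add: powr_half_sqrt)
  qed
  have "(9 * sqrt 3 + 7) ^ 2 < (16 * sqrt (2 :: real)) ^ 2"
  proof -
    \<comment> \<open>Expanding the squares turns the claim into
      \<open>292 + 126 * sqrt 3 < 512\<close>.\<close>
    have "sqrt 3 < sqrt ((220 / 126) ^ 2)"
      by (subst real_sqrt_less_iff) (simp add: power2_eq_square)
    then have "sqrt 3 < 220 / 126" by (simp del: real_sqrt_less_iff)
    then show ?thesis by (simp add: power2_sum power_mult_distrib)
  qed
  then have "9 * sqrt 3 + 7 < 16 * sqrt (2 :: real)"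
    by (rule power_less_imp_less_base) simp
  moreover have "2 powr (5 / 2) * root_fun (5 / 2) = 3 powr (5 / 2) - 2 powr (5 / 2) * 4 + 7"
    unfolding root_fun_eq[symmetric] by (subst powr_add) simp
  ultimately have "2 powr (5 / 2) * root_fun (5 / 2) < 0"
    using split[of 2] split[of 3] by simp
  then show ?thesis by (simp add: mult_less_0_iff)
qed

lemma continuous_on_root_fun: "continuous_on S root_fun"
  unfolding root_fun_def by (auto intro!: continuous_intros)

lemma root_fun_IVT:
  assumes "x \<le> y" "root_fun x * root_fun y \<le> 0"
  shows "\<exists>z. x \<le> z \<and> z \<le> y \<and> root_fun z = 0"
  using assms IVT'[of root_fun x 0 y] IVT2'[of root_fun y 0 x] continuous_on_root_fun
  by (auto simp: mult_le_0_iff)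

text \<open>Together with 2 there would be three zeros, so by Rolle's theorem two zeros of the
  derivative \<open>D\<close>, which is strictly increasing.\<close>

lemma root_fun_unique:
  assumes "2 < u" "u < v" "root_fun u = 0" "root_fun v = 0"
  shows False
proof -
  define D where "D = (\<lambda>s::real. ln (3 / 2) * (3 / 2) powr s - 7 * ln 2 * (1 / 2) powr s)"
  have deriv: "(root_fun has_real_derivative D s) (at s)" for s
    unfolding root_fun_def D_def
    by (auto intro!: derivative_eq_intros simp: ln_div)
  obtain x where x: "2 < x" "x < u" "D x = 0"
    using MVT2[of 2 u root_fun D] deriv assms root_fun_2 by auto
  obtain y where y: "u < y" "D y = 0"
    using MVT2[of u v root_fun D] deriv assms by auto
  have "ln (3 / 2) * (3 / 2) powr x < ln (3 / 2) * (3 / 2 :: real) powr y"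
    using x y by (intro mult_strict_left_mono powr_less_mono) auto
  moreover have "7 * ln 2 * (1 / 2 :: real) powr y \<le> 7 * ln 2 * (1 / 2) powr x"
    using x y by (intro mult_left_mono) (auto simp: powr_mono')
  moreover have "ln (3 / 2) * (3 / 2) powr x = 7 * ln 2 * (1 / 2) powr x"
    "ln (3 / 2) * (3 / 2) powr y = 7 * ln 2 * (1 / 2) powr y"
    using x(3) y(2) by (simp_all add: D_def)
  ultimately show False by linarith
qed

text \<open>The substitution \<open>s = 3 - 2 * x\<close> maps (0, 1/2) onto (2, 3) and reverses the
  order, so \<open>\<beta>\<close> above \<open>beta0\<close> means \<open>s\<close> below the root
  of \<open>root_fun\<close>.\<close>

lemma is_root_beta_iff:
  "is_root_beta x \<longleftrightarrow> 2 < 3 - 2 * x \<and> 3 - 2 * x < 3 \<and> root_fun (3 - 2 * x) = 0"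
proof -
  have "3 powr (3 - 2 * x) - 2 powr (5 - 2 * x) + 7 = 2 powr (3 - 2 * x) * root_fun (3 - 2 * x)"
    using root_fun_eq[of "3 - 2 * x"] by simp
  then show ?thesis by (auto simp: is_root_beta_def)
qed

lemma ex1_is_root_beta: "\<exists>!x. is_root_beta x"
proof (rule ex_ex1I)
  obtain z where z: "5 / 2 \<le> z" "z \<le> 3" "root_fun z = 0"
    using root_fun_IVT[of "5 / 2" 3] root_fun_3 root_fun_5_half by (auto simp: mult_le_0_iff)
  have "z \<noteq> 3" using z(3) root_fun_3 by auto
  with z show "\<exists>x. is_root_beta x"
    by (intro exI[of _ "(3 - z) / 2"]) (auto simp: is_root_beta_iff field_simps)
next
  fix x y assume "is_root_beta x" "is_root_beta y"
  then show "x = y"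
    using root_fun_unique[of "3 - 2 * x" "3 - 2 * y"] root_fun_unique[of "3 - 2 * y" "3 - 2 * x"]
    by (cases x y rule: linorder_cases) (auto simp: is_root_beta_iff)
qed

lemma is_root_beta_beta0: "is_root_beta beta0"
  unfolding beta0_def using ex1_is_root_beta by (rule theI')

lemma root_fun_neq_0:
  assumes "2 < s" "s < 3" "s \<noteq> 3 - 2 * beta0"
  shows "root_fun s \<noteq> 0"
proof
  assume "root_fun s = 0"
  moreover have "3 - 2 * ((3 - s) / 2) = s" by (simp add: field_simps)
  ultimately have "is_root_beta ((3 - s) / 2)"
    using assms unfolding is_root_beta_iff by metis
  then have "(3 - s) / 2 = beta0"
    using ex1_is_root_beta is_root_beta_beta0 by blast
  with assms show False by simp
qed

text \<open>A nonpositive value at \<open>s\<close> and the positive value at 3 would enclose a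
  second zero.\<close>

lemma root_fun_pos:
  assumes "3 - 2 * beta0 < s" "s < 3"
  shows "root_fun s > 0"
proof (rule ccontr)
  assume "\<not> root_fun s > 0"
  then obtain z where z: "s \<le> z" "z \<le> 3" "root_fun z = 0"
    using root_fun_IVT[of s 3] root_fun_3 assms by (auto simp: mult_le_0_iff)
  have "z \<noteq> 3" using z(3) root_fun_3 by auto
  then show False
    using root_fun_neq_0[of z] z assms is_root_beta_beta0 by (auto simp: is_root_beta_iff)
qed

lemma root_fun_neg:
  assumes "2 < s" "s < 3 - 2 * beta0"
  shows "root_fun s < 0"
proof (rule ccontr)
  assume "\<not> root_fun s < 0"
  \<comment> \<open>This puts 5/2, where the sign is known, on the same side of the root as
    \<open>s\<close>.\<close>
  moreover have "5 / 2 < 3 - 2 * beta0"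
  proof (rule ccontr)
    assume "\<not> ?thesis"
    then consider "5 / 2 = 3 - 2 * beta0" | "3 - 2 * beta0 < 5 / 2" by linarith
    then show False
      using root_fun_pos[of "5 / 2"] root_fun_5_half is_root_beta_beta0
      by cases (auto simp: is_root_beta_iff)
  qed
  ultimately obtain z where "min s (5 / 2) \<le> z" "z \<le> max s (5 / 2)" "root_fun z = 0"
    using root_fun_IVT[of s "5 / 2"] root_fun_IVT[of "5 / 2" s] root_fun_5_half
    by (cases "s \<le> 5 / 2") (auto simp: mult_le_0_iff)
  moreover have "3 - 2 * beta0 < 3"
    using is_root_beta_beta0 by (simp add: is_root_beta_iff)
  ultimately show False
    using root_fun_neq_0[of z] assms \<open>5 / 2 < 3 - 2 * beta0\<close> by linarith
qed

subsection \<open>M-matrices\<close>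

text \<open>The minimum principle: look at a row in which \<open>v\<close> attains its minimum.\<close>

lemma mult_mat_vec_nonneg_imp_nonneg:
  fixes A :: "real mat" and v :: "real Matrix.vec"
  assumes A: "A \<in> carrier_mat n n"
    and off: "\<And>i j. i < n \<Longrightarrow> j < n \<Longrightarrow> i \<noteq> j \<Longrightarrow> A $$ (i, j) \<le> 0"
    and row: "\<And>i. i < n \<Longrightarrow> (\<Sum>j<n. A $$ (i, j)) > 0"
    and v: "v \<in> carrier_vec n" and Av: "\<And>i. i < n \<Longrightarrow> (A *\<^sub>v v) $ i \<ge> 0"
    and "i < n"
  shows "v $ i \<ge> 0"
proof -
  obtain k where k: "k < n" "\<And>j. j < n \<Longrightarrow> v $ k \<le> v $ j"
    using ex_min_if_finite[of "(\<lambda>i. v $ i) ` {..<n}"] \<open>i < n\<close> by (auto simp: not_less)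
  have "0 \<le> (A *\<^sub>v v) $ k" using Av k(1) .
  also have "\<dots> = (\<Sum>j<n. A $$ (k, j) * v $ j)"
    using A v k(1) by (simp add: scalar_prod_def lessThan_atLeast0)
  also have "\<dots> \<le> (\<Sum>j<n. A $$ (k, j) * v $ k)"
  proof (rule sum_mono)
    fix j assume "j \<in> {..<n}"
    then show "A $$ (k, j) * v $ j \<le> A $$ (k, j) * v $ k"
      using off[of k j] k by (cases "j = k") (auto intro: mult_left_mono_neg)
  qed
  also have "\<dots> = (\<Sum>j<n. A $$ (k, j)) * v $ k" by (simp add: sum_distrib_right)
  finally have "v $ k \<ge> 0" using row[OF k(1)] by (simp add: zero_le_mult_iff)
  then show ?thesis using k(2)[OF \<open>i < n\<close>] by linarith
qed

text \<open>The minimum principle for \<open>v\<close> and \<open>- v\<close> shows that the kernel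
  is trivial. It also applies to the columns of an inverse, since \<open>A\<close> maps them to unit
  vectors.\<close>

lemma M_matrix_if_row_sums_pos:
  assumes A: "A \<in> carrier_mat n n"
    and off: "\<And>i j. i < n \<Longrightarrow> j < n \<Longrightarrow> i \<noteq> j \<Longrightarrow> A $$ (i, j) \<le> 0"
    and row: "\<And>i. i < n \<Longrightarrow> (\<Sum>j<n. A $$ (i, j)) > 0"
  shows "M_matrix A"
proof -
  note nonneg = mult_mat_vec_nonneg_imp_nonneg[OF A off row]
  have diag: "A $$ (i, i) > 0" if "i < n" for i
  proof -
    have "(\<Sum>j\<in>{..<n} - {i}. A $$ (i, j)) \<le> 0"
      using off that by (intro sum_nonpos) auto
    then show ?thesis
      using row[OF that] that by (simp add: sum.remove[of "{..<n}" i])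
  qed
  have "det A \<noteq> 0"
  proof
    assume "det A = 0"
    then obtain v where v: "v \<in> carrier_vec n" "v \<noteq> 0\<^sub>v n" "A *\<^sub>v v = 0\<^sub>v n"
      using det_0_iff_vec_prod_zero_field[OF A] by blast
    have "v $ i = 0" if "i < n" for i
    proof -
      have neg: "A *\<^sub>v (- v) = - (A *\<^sub>v v)"
        using A v(1) by (intro eq_vecI) (auto simp: scalar_prod_def sum_negf)
      have "(- v) $ i \<ge> 0" by (rule nonneg) (use v that neg in auto)
      moreover have "v $ i \<ge> 0" by (rule nonneg) (use v that in auto)
      ultimately show ?thesis using v(1) that by simp
    qed
    then have "v = 0\<^sub>v n" using v(1) by (intro eq_vecI) auto
    with v(2) show False ..
  qed
  then have "A \<in> Units (ring_mat TYPE(real) n ())" by (rule det_non_zero_imp_unit[OF A])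
  then obtain C where C: "C \<in> carrier_mat n n" "A * C = 1\<^sub>m n" "C * A = 1\<^sub>m n"
    by (auto simp: Units_def ring_mat_simps)
  have inv: "B $$ (i, j) \<ge> 0" if B: "inverts_mat A B" "inverts_mat B A" and ij: "i < n" "j < n" for B i j
  proof -
    have AB: "A * B = 1\<^sub>m n" using B A by (simp add: inverts_mat_def)
    \<comment> \<open>\<open>M_matrix\<close> does not fix the dimensions of \<open>B\<close>; they
      are read off from the two products.\<close>
    have "B * A = 1\<^sub>m (dim_row B)" using B(2) by (simp add: inverts_mat_def)
    from arg_cong[OF this, of dim_col] have "dim_row B = n" using A by simp
    moreover have "dim_col B = n" using arg_cong[OF AB, of dim_col] by simp
    ultimately have Bc: "B \<in> carrier_mat n n" by auto
    have col: "A *\<^sub>v col B j = col (1\<^sub>m n) j"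
      using A Bc ij by (subst AB[symmetric]) (auto intro!: eq_vecI)
    have "col B j $ i \<ge> 0"
      by (rule nonneg) (use col ij Bc in auto)
    then show ?thesis using ij Bc by simp
  qed
  have "invertible_mat A"
    using A C by (auto simp: invertible_mat_def inverts_mat_def)
  then show ?thesis
    using A off diag inv by (auto simp: M_matrix_def)
qed

subsection \<open>The stiffness matrix\<close>

locale stiffness =
  fixes \<beta> h :: real
  assumes beta: "0 < \<beta>" "\<beta> < 1 / 2" and h: "0 < h"
begin

definition s :: real where
  "s = 3 - 2 * \<beta>"

definition c :: real where
  "c = h powr (1 - 2 * \<beta>) / (2 * cos (\<beta> * pi) * Gamma (4 - 2 * \<beta>))"

text \<open>The absolute value makes the differenced function even, so that one formula covers the
  entries on, next to and far from the diagonal.\<close>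

definition D :: "real \<Rightarrow> real" where
  "D = fwd_diff 3 (\<lambda>y. \<bar>y\<bar> powr s)"

lemma s_bounds: "2 < s" "s < 3"
  using beta by (auto simp: s_def)

lemma cos_pos: "cos (\<beta> * pi) > 0"
  using beta by (intro cos_gt_zero_pi) (auto simp: field_simps intro: less_le_trans[of _ 0])

lemma c_pos: "c > 0"
  using h beta cos_pos by (auto simp: c_def intro!: divide_pos_pos mult_pos_pos Gamma_real_pos)

text \<open>Two uses of \<open>Gamma (x + 1) = x * Gamma x\<close>: the bound for interior rows
  involves \<open>Gamma (2 - 2 * \<beta>)\<close>, while \<open>c\<close> contains
  \<open>Gamma (4 - 2 * \<beta>)\<close>.\<close>

lemma c_eq: "c * (s * (s - 1)) = h powr (1 - 2 * \<beta>) / (2 * cos (\<beta> * pi) * Gamma (2 - 2 * \<beta>))"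
proof -
  have cancel: "x / (y * (k * g)) * k = x / (y * g)" if "k \<noteq> 0" for x y k g :: real
    using that by simp
  have "Gamma (4 - 2 * \<beta>) = s * Gamma s"
    using Gamma_plus1[of s] s_bounds by (force simp: s_def elim: nonpos_Ints_cases)
  also have "Gamma s = (s - 1) * Gamma (2 - 2 * \<beta>)"
    using Gamma_plus1[of "s - 1"] s_bounds by (force simp: s_def elim: nonpos_Ints_cases)
  finally have "Gamma (4 - 2 * \<beta>) = s * (s - 1) * Gamma (2 - 2 * \<beta>)"
    by simp
  then show ?thesis
    unfolding c_def using s_bounds by (simp only:) (rule cancel, simp)
qed

lemma powr_shifts: "2 powr (4 - 2 * \<beta>) = 2 * 2 powr s" "2 powr (5 - 2 * \<beta>) = 4 * 2 powr s"
  "3 - 2 * \<beta> = s"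
  using powr_add[of 2 1 s] powr_add[of 2 2 s] by (simp_all add: s_def)

section \<open>Signs of the entries\<close>

lemma entry_diag: "stiff_entry \<beta> h i i = c * (2 * 2 powr s - 8)"
  by (simp add: stiff_entry_def c_def powr_shifts)

lemma entry_next:
  assumes "\<bar>real i - real j\<bar> = 1"
  shows "stiff_entry \<beta> h i j = c * (2 powr s * root_fun s)"
  using root_fun_eq[of s] assms
  by (simp add: stiff_entry_def c_def powr_shifts powr_add)

text \<open>At distance \<open>l\<close> the nodes run from \<open>l - 2\<close> to
  \<open>l + 2\<close>, hence the base point \<open>l - 2\<close>; all of them are
  nonnegative.\<close>

lemma entry_far:
  assumes "\<bar>real i - real j\<bar> \<ge> 2"
  shows "stiff_entry \<beta> h i j = c * fwd_diff 4 (\<lambda>y. y powr s) (\<bar>real i - real j\<bar> - 2)"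
proof -
  have "i \<noteq> j" using assms by auto
  then show ?thesis
    using assms by (simp add: stiff_entry_def Let_def c_def powr_shifts fwd_diff_4 add.commute)
qed

lemma distance_cases:
  fixes i j :: nat
  obtains "i = j" | "\<bar>real i - real j\<bar> = 1" | "\<bar>real i - real j\<bar> \<ge> 2"
proof -
  have "i = j \<or> i = Suc j \<or> j = Suc i \<or> i \<ge> j + 2 \<or> j \<ge> i + 2" by linarith
  then show ?thesis using that by (elim disjE) auto
qed

lemma entry_far_neg:
  assumes "\<bar>real i - real j\<bar> \<ge> 2"
  shows "stiff_entry \<beta> h i j < 0"
  using fwd_diff_4_powr_neg[of "\<bar>real i - real j\<bar> - 2" s] c_pos s_bounds assms
  by (simp add: entry_far mult_less_0_iff)

lemma entry_diag_pos: "stiff_entry \<beta> h i i > 0"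
proof -
  have "2 powr 2 < 2 powr s" using s_bounds by (intro powr_less_mono) auto
  then show ?thesis using c_pos by (simp add: entry_diag)
qed

lemma entry_next_neg:
  assumes "beta0 < \<beta>" "\<bar>real i - real j\<bar> = 1"
  shows "stiff_entry \<beta> h i j < 0"
  using root_fun_neg[of s] assms c_pos s_bounds by (simp add: entry_next mult_less_0_iff s_def)

lemma entry_next_pos:
  assumes "\<beta> < beta0" "\<bar>real i - real j\<bar> = 1"
  shows "stiff_entry \<beta> h i j > 0"
  using root_fun_pos[of s] assms c_pos s_bounds by (simp add: entry_next zero_less_mult_iff s_def)

lemma entry_next_root:
  assumes "\<beta> = beta0" "\<bar>real i - real j\<bar> = 1"
  shows "stiff_entry \<beta> h i j = 0"
proof -
  have "root_fun s = 0"
    using is_root_beta_beta0[folded assms(1)] by (simp add: s_def is_root_beta_iff)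
  then show ?thesis by (simp add: entry_next[OF assms(2)])
qed

lemma entry_off_diag_nonpos:
  assumes "beta0 \<le> \<beta>" "i \<noteq> j"
  shows "stiff_entry \<beta> h i j \<le> 0"
  using assms entry_far_neg entry_next_neg entry_next_root
  by (cases i j rule: distance_cases) (force simp: order_le_less)+

section \<open>Row sums as third differences\<close>

lemma D_reflect: "D (- 3 - x) = - D x"
proof -
  \<comment> \<open>The nodes are the negatives of those based at \<open>x\<close>, in reverse
    order, and reversal changes the sign of the coefficients of a third difference.\<close>
  have "\<bar>- 3 - x\<bar> = \<bar>x + 3\<bar>" "\<bar>- 3 - x + 1\<bar> = \<bar>x + 2\<bar>" "\<bar>- 3 - x + 2\<bar> = \<bar>x + 1\<bar>"
    "\<bar>- 3 - x + 3\<bar> = \<bar>x\<bar>"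
    by linarith+
  then show ?thesis by (simp add: D_def fwd_diff_3)
qed

text \<open>A fourth difference is the difference of two consecutive third differences; the centre
  \<open>i - j\<close> corresponds to the base point \<open>i - j - 2\<close>.\<close>

lemma entry_eq_D_diff:
  "stiff_entry \<beta> h i j = c * (D (real i - real j - 1) - D (real i - real j - 2))"
proof (cases i j rule: distance_cases)
  case 1
  then show ?thesis by (simp add: entry_diag D_def fwd_diff_3)
next
  case 2
  have "stiff_entry \<beta> h i j = c * (3 powr s - 4 * 2 powr s + 7)"
    using root_fun_eq[of s] by (simp add: entry_next[OF 2] powr_add)
  moreover have "real i - real j = 1 \<or> real i - real j = - 1" using 2 by linarith
  ultimately show ?thesis by (auto simp: D_def fwd_diff_3)
next
  case 3
  then have "real i - real j \<ge> 2 \<or> real i - real j \<le> - 2" by linarith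
  then show ?thesis
  proof
    assume d: "real i - real j \<ge> 2"
    then show ?thesis
      using entry_far[OF 3] by (simp add: D_def fwd_diff_3 fwd_diff_4 add.commute)
  next
    assume d: "real i - real j \<le> - 2"
    \<comment> \<open>Here all nodes are nonpositive; reflection leads to the base points
      \<open>e\<close> and \<open>e + 1\<close> on the nonnegative side.\<close>
    define e where "e = real j - real i - 2"
    have e: "e \<ge> 0" "real i - real j - 1 = - 3 - e" "real i - real j - 2 = - 3 - (e + 1)"
      "\<bar>real i - real j\<bar> - 2 = e"
      using d by (auto simp: e_def)
    show ?thesis
      unfolding entry_far[OF 3] e(2-4) D_reflect
      using e(1) by (simp add: D_def fwd_diff_3 fwd_diff_4 add.commute)
  qed
qed

lemma D_minus_1: "D (- 1) = 2 powr s - 4"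
  by (simp add: D_def fwd_diff_3)

lemma D_nonneg_eq: "0 \<le> x \<Longrightarrow> D x = fwd_diff 3 (\<lambda>y. y powr s) x"
  by (simp add: D_def fwd_diff_3)

text \<open>For \<open>i = 1\<close> the nodes -1, 0, 1, 2 straddle the origin and the value is
  computed directly; for larger \<open>i\<close> they are all nonnegative.\<close>

lemma D_pos:
  assumes "1 \<le> i"
  shows "D (real i - 2) > 0"
proof (cases "i = 1")
  case True
  have "2 powr 2 < 2 powr s" using s_bounds by (intro powr_less_mono) auto
  with True show ?thesis by (simp add: D_minus_1)
next
  case False
  then show ?thesis
    using assms s_bounds by (simp add: D_nonneg_eq fwd_diff_3_powr_pos)
qed

text \<open>The sum over \<open>j\<close> telescopes to its two ends; reflecting the second one
  makes the formula symmetric in \<open>i\<close> and \<open>M - i\<close>.\<close>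

lemma row_sum:
  assumes "i \<in> {1..M - 1}"
  shows "(\<Sum>j = 1..M - 1. stiff_entry \<beta> h i j) = c * (D (real i - 2) + D (real (M - i) - 2))"
proof -
  have "(\<Sum>j = 1..M - 1. stiff_entry \<beta> h i j) =
      c * (\<Sum>j = 1..M - 1. - D (real i - real (Suc j) - 1) - (- D (real i - real j - 1)))"
    unfolding sum_distrib_left by (intro sum.cong) (auto simp: entry_eq_D_diff algebra_simps)
  also have "\<dots> = c * (D (real i - 2) - D (real i - real M - 1))"
    using assms by (subst sum_Suc_diff) auto
  also have "D (real i - real M - 1) = - D (real (M - i) - 2)"
  proof -
    have "i \<le> M" using assms by auto
    then have "- 3 - (real (M - i) - 2) = real i - real M - 1"
      by (simp add: of_nat_diff)
    then show ?thesis using D_reflect[of "real (M - i) - 2"] by simp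
  qed
  finally show ?thesis by simp
qed

lemma row_sum_pos:
  assumes "i \<in> {1..M - 1}"
  shows "(\<Sum>j = 1..M - 1. stiff_entry \<beta> h i j) > 0"
proof -
  have "1 \<le> i" "1 \<le> M - i" using assms by auto
  then show ?thesis
    unfolding row_sum[OF assms] using c_pos by (intro mult_pos_pos add_pos_pos D_pos)
qed

lemma row_sum_boundary:
  assumes "i \<in> {1..M - 1}" "i = 1 \<or> i = M - 1"
  shows "(\<Sum>j = 1..M - 1. stiff_entry \<beta> h i j)
    \<ge> - (h powr (1 - 2 * \<beta>) * (4 - 2 powr (3 - 2 * \<beta>)) / (2 * cos (\<beta> * pi) * Gamma (4 - 2 * \<beta>)))"
proof -
  have "D (- 1) \<le> D (real i - 2) + D (real (M - i) - 2)"
    using assms D_pos[of i] D_pos[of "M - i"] by auto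
  then have "c * (2 powr s - 4) \<le> (\<Sum>j = 1..M - 1. stiff_entry \<beta> h i j)"
    unfolding row_sum[OF assms(1)] using c_pos by (simp add: D_minus_1)
  then show ?thesis
    by (simp add: c_def s_def diff_divide_distrib right_diff_distrib)
qed

text \<open>Both third differences are bounded below by the tangent at \<open>M / 2\<close>. Their
  midpoints \<open>i - 1 / 2\<close> and \<open>M - i - 1 / 2\<close> add up to
  \<open>M - 1\<close>, so the linear terms add up to \<open>- T\<close> whatever \<open>i\<close>
  is.\<close>

lemma row_sum_interior:
  assumes "i \<in> {2..M - 2}"
  shows "(\<Sum>j = 1..M - 1. stiff_entry \<beta> h i j)
    \<ge> - (2 powr (2 * \<beta>) * h * (2 * \<beta> - 1) / (cos (\<beta> * pi) * Gamma (2 - 2 * \<beta>)))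
      * (h * real M) powr (- 2 * \<beta>)"
proof -
  have M: "real M > 0" "i \<in> {1..M - 1}" using assms by auto
  let ?m = "real M / 2"
  define A where "A = s * (s - 1) * (s - 2)"
  define T where "T = (s - 3) * ?m powr (s - 4)"
  have A: "A > 0" using s_bounds by (simp add: A_def)
  have ge: "A * (?m powr (s - 3) + T * (x + 3 / 2 - ?m)) \<le> D x" if "0 \<le> x" for x
    using fwd_diff_3_powr_ge[of s ?m x] s_bounds M that
    by (simp add: A_def T_def D_nonneg_eq)
  have "0 \<le> real i - 2" "0 \<le> real (M - i) - 2" using assms by auto
  note this[THEN ge]
  moreover have "A * (?m powr (s - 3) + T * (real i - 2 + 3 / 2 - ?m))
      + A * (?m powr (s - 3) + T * (real (M - i) - 2 + 3 / 2 - ?m)) = A * (2 * ?m powr (s - 3) - T)"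
  proof -
    have "real (M - i) = real M - real i" using assms by auto
    then show ?thesis by (simp add: field_simps)
  qed
  \<comment> \<open>Since \<open>s < 3\<close>, \<open>T\<close> is nonpositive and
    \<open>- T\<close> may be dropped.\<close>
  moreover have "A * (2 * ?m powr (s - 3)) \<le> A * (2 * ?m powr (s - 3) - T)"
    using A s_bounds by (intro mult_left_mono) (auto simp: T_def mult_le_0_iff)
  ultimately have "A * (2 * ?m powr (s - 3)) \<le> D (real i - 2) + D (real (M - i) - 2)"
    by linarith
  then have "c * (A * (2 * ?m powr (s - 3))) \<le> (\<Sum>j = 1..M - 1. stiff_entry \<beta> h i j)"
    unfolding row_sum[OF M(2)] using c_pos by simp
  moreover have "c * (A * (2 * ?m powr (s - 3))) =
      - (2 powr (2 * \<beta>) * h * (2 * \<beta> - 1) / (cos (\<beta> * pi) * Gamma (2 - 2 * \<beta>)))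
      * (h * real M) powr (- 2 * \<beta>)"
  proof -
    \<comment> \<open>\<open>e\<close>, \<open>P\<close> and \<open>Q\<close> stand for
      \<open>h powr (- 2 * \<beta>)\<close>, \<open>2 powr (2 * \<beta>)\<close> and
      \<open>real M powr (- 2 * \<beta>)\<close>.\<close>
    have alg: "h * e / (2 * C * G) * (2 * (1 - 2 * \<beta>) * (P * Q)) =
        - (P * h * (2 * \<beta> - 1) / (C * G)) * (e * Q)" for e C G P Q :: real
      by (cases "C = 0 \<or> G = 0") (auto simp: field_simps)
    have "c * (A * (2 * ?m powr (s - 3))) =
        (c * (s * (s - 1))) * (2 * (1 - 2 * \<beta>) * ?m powr (- 2 * \<beta>))"
      by (simp add: A_def s_def)
    moreover have "?m powr (- 2 * \<beta>) = 2 powr (2 * \<beta>) * real M powr (- 2 * \<beta>)"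
      using M by (simp add: powr_divide powr_minus field_simps)
    moreover have "h powr (1 - 2 * \<beta>) = h * h powr (- 2 * \<beta>)"
      using h powr_add[of h 1 "- 2 * \<beta>"] by simp
    moreover have "(h * real M) powr (- 2 * \<beta>) = h powr (- 2 * \<beta>) * real M powr (- 2 * \<beta>)"
      using h M by (simp add: powr_mult)
    ultimately show ?thesis by (simp only: c_eq alg)
  qed
  ultimately show ?thesis by simp
qed

section \<open>Characterisation of the M-matrix case\<close>

lemma M_matrix_stiff_mat:
  assumes "beta0 \<le> \<beta>"
  shows "M_matrix (stiff_mat \<beta> h M)"
proof (rule M_matrix_if_row_sums_pos)
  show "stiff_mat \<beta> h M \<in> carrier_mat (M - 1) (M - 1)" by (simp add: stiff_mat_def)
  show "stiff_mat \<beta> h M $$ (i, j) \<le> 0" if "i < M - 1" "j < M - 1" "i \<noteq> j" for i j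
    using that entry_off_diag_nonpos[OF assms] by (simp add: stiff_mat_def)
  show "(\<Sum>j<M - 1. stiff_mat \<beta> h M $$ (i, j)) > 0" if "i < M - 1" for i
  proof -
    have "(\<Sum>j<M - 1. stiff_mat \<beta> h M $$ (i, j)) = (\<Sum>j<M - 1. stiff_entry \<beta> h (i + 1) (Suc j))"
      using that by (intro sum.cong) (auto simp: stiff_mat_def)
    also have "\<dots> = (\<Sum>j = 1..M - 1. stiff_entry \<beta> h (i + 1) j)"
      by (simp only: sum.shift_bounds_Suc_ivl[symmetric] lessThan_atLeast0
            atLeastLessThanSuc_atLeastAtMost One_nat_def)
    finally show ?thesis using row_sum_pos[of "i + 1" M] that by simp
  qed
qed

text \<open>For smaller \<open>\<beta>\<close> the entries next to the diagonal are positive;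
  \<open>3 \<le> M\<close> ensures that the matrix has such an entry.\<close>

lemma beta0_le_if_M_matrix:
  assumes "M_matrix (stiff_mat \<beta> h M)" "3 \<le> M"
  shows "beta0 \<le> \<beta>"
proof (rule ccontr)
  assume "\<not> beta0 \<le> \<beta>"
  then have "stiff_mat \<beta> h M $$ (0, 1) > 0"
    using entry_next_pos[of 1 2] assms(2) by (simp add: stiff_mat_def numeral_2_eq_2)
  moreover have "stiff_mat \<beta> h M $$ (0, 1) \<le> 0"
  proof -
    have "\<forall>i<M - 1. \<forall>j<M - 1. i \<noteq> j \<longrightarrow> stiff_mat \<beta> h M $$ (i, j) \<le> 0"
      using assms(1) by (simp add: M_matrix_def stiff_mat_def)
    from this[rule_format, of 0 1] show ?thesis using assms(2) by simp
  qed
  ultimately show False by simp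
qed

end

text \<open>The estimate for interior rows carries the factor
  \<open>(b - a) powr (- 2 * \<beta>)\<close>, which is at least 1 when
  \<open>b - a \<le> 1\<close>; this gives the bound without the factor.\<close>

theorem theorem1:
  fixes a b \<beta> h :: real and M :: nat
  assumes "0 < \<beta>" and "\<beta> < 1 / 2"
    and "a < b" and "0 < M" and "h = (b - a) / real M"
  shows "(\<exists>!x. is_root_beta x) \<and>
    (\<forall>i\<in>{1..M - 1}. stiff_entry \<beta> h i i > 0) \<and>
    (beta0 < \<beta> \<longrightarrow>
           (\<forall>i\<in>{1..M - 1}. \<forall>j\<in>{1..M - 1}. i \<noteq> j \<longrightarrow> stiff_entry \<beta> h i j < 0)) \<and>
    (\<not> beta0 < \<beta> \<longrightarrow>
           (\<forall>k\<in>{1..M - 2}. stiff_entry \<beta> h k (k + 1) = stiff_entry \<beta> h (k + 1) k \<and>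
                           stiff_entry \<beta> h (k + 1) k \<ge> 0) \<and>
           (\<forall>i\<in>{1..M - 1}. \<forall>j\<in>{1..M - 1}. \<bar>int i - int j\<bar> > 1 \<longrightarrow> stiff_entry \<beta> h i j < 0)) \<and>
    (\<forall>i\<in>{1..M - 1}. (\<Sum>j = 1..M - 1. stiff_entry \<beta> h i j) > 0) \<and>
    (beta0 \<le> \<beta> \<longrightarrow> M_matrix (stiff_mat \<beta> h M)) \<and>
    (3 \<le> M \<longrightarrow> (M_matrix (stiff_mat \<beta> h M) \<longleftrightarrow> beta0 \<le> \<beta>)) \<and>
    (h \<le> 1 / 7 \<longrightarrow>
           (\<forall>i\<in>{1..M - 1}. i = 1 \<or> i = M - 1 \<longrightarrow>
              (\<Sum>j = 1..M - 1. stiff_entry \<beta> h i j)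
                \<ge> - (h powr (1 - 2 * \<beta>) * (4 - 2 powr (3 - 2 * \<beta>)) /
                     (2 * cos (\<beta> * pi) * Gamma (4 - 2 * \<beta>))))) \<and>
    (h \<le> 1 / 7 \<and> b - a \<le> 1 \<longrightarrow>
           (\<forall>i\<in>{2..M - 2}.
              (\<Sum>j = 1..M - 1. stiff_entry \<beta> h i j)
                \<ge> - (2 powr (2 * \<beta>) * h * (2 * \<beta> - 1) / (cos (\<beta> * pi) * Gamma (2 - 2 * \<beta>))))) \<and>
    (h \<le> 1 / 7 \<longrightarrow>
           (\<forall>i\<in>{2..M - 2}.
              (\<Sum>j = 1..M - 1. stiff_entry \<beta> h i j)
                \<ge> - (2 powr (2 * \<beta>) * h * (2 * \<beta> - 1) / (cos (\<beta> * pi) * Gamma (2 - 2 * \<beta>)))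
                    * (b - a) powr (- 2 * \<beta>)))"
proof -
  have h: "0 < h" using assms by simp
  interpret stiffness \<beta> h by standard (use assms h in auto)
  have len: "h * real M = b - a" using assms by simp
  have far: "\<bar>int i - int j\<bar> > 1 \<longleftrightarrow> \<bar>real i - real j\<bar> \<ge> 2" for i j :: nat by linarith
  have off: "stiff_entry \<beta> h i j < 0" if "beta0 < \<beta>" "i \<noteq> j" for i j
    using that entry_next_neg entry_far_neg by (cases i j rule: distance_cases) auto
  have next_nonneg: "stiff_entry \<beta> h k (k + 1) = stiff_entry \<beta> h (k + 1) k \<and>
      stiff_entry \<beta> h (k + 1) k \<ge> 0" if "\<not> beta0 < \<beta>" for k
    using that entry_next_pos[of "k + 1" k] entry_next_root[of "k + 1" k]
      entry_next[of "k + 1" k] entry_next[of k "k + 1"]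
    by (cases "\<beta> = beta0") auto
  have unit: "- (2 powr (2 * \<beta>) * h * (2 * \<beta> - 1) / (cos (\<beta> * pi) * Gamma (2 - 2 * \<beta>)))
      \<le> (\<Sum>j = 1..M - 1. stiff_entry \<beta> h i j)" if "i \<in> {2..M - 2}" "b - a \<le> 1" for i
  proof -
    \<comment> \<open>\<open>K\<close> is nonnegative because \<open>2 * \<beta> - 1\<close> is
      negative, so multiplying it by a factor of at least 1 does not decrease it.\<close>
    define K where "K = - (2 powr (2 * \<beta>) * h * (2 * \<beta> - 1) / (cos (\<beta> * pi) * Gamma (2 - 2 * \<beta>)))"
    have "K = 2 powr (2 * \<beta>) * h * (1 - 2 * \<beta>) / (cos (\<beta> * pi) * Gamma (2 - 2 * \<beta>))"
      unfolding K_def minus_divide_left mult_minus_right[symmetric] by simp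
    also have "\<dots> \<ge> 0"
      using assms(1,2) h cos_pos
      by (intro divide_nonneg_nonneg mult_nonneg_nonneg order_less_imp_le[OF Gamma_real_pos]) auto
    finally have "K \<ge> 0" .
    moreover have "1 \<le> (b - a) powr (- 2 * \<beta>)"
      using powr_mono'[of "- 2 * \<beta>" 0 "b - a"] assms that by auto
    ultimately have "K * 1 \<le> K * (b - a) powr (- 2 * \<beta>)" by (intro mult_left_mono)
    then show ?thesis using row_sum_interior[OF that(1)] by (simp add: K_def len)
  qed
  show ?thesis
    using ex1_is_root_beta entry_diag_pos off next_nonneg entry_far_neg row_sum_pos
      M_matrix_stiff_mat beta0_le_if_M_matrix row_sum_boundary row_sum_interior[of _ M, unfolded len] unit
    unfolding far by blast
qed

end
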